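(* Let $f:\mathbb{Z}^n\to\mathbb{R}\cup\{+\infty\}$ be a DDM-convex function, $\alpha$ a positive integer and $x^\alpha\in\operatorname{dom} f$. If $f(x^\alpha)\le f(x^\alpha+\alpha d)$ for all $d\in\{-1,0,+1\}^n$, then there exists $x^*\in\operatorname{argmin} f$ with $\|x^\alpha-x^*\|_\infty\le n(\alpha-1)$.
   Context: $\operatorname{dom} f=\{x\in\mathbb{Z}^n\mid f(x)<+\infty\}$ and $\operatorname{argmin} f=\{x\in\mathbb{Z}^n\mid f(x)\le f(z)\ \forall z\in\mathbb{Z}^n\}$. Here $x^\alpha$ is just the name of a point of $\mathbb{Z}^n$. For $x,y\in\mathbb{Z}^n$, the vector $\mu(x,y)\in\mathbb{Z}^n$ is defined componentwise by $\mu(x,y)_i=\lceil (x_i+y_i)/2\rceil$ if $x_i\ge y_i$, and $\mu(x,y)_i=\lfloor (x_i+y_i)/2\rfloor$ if $x_i<y_i$. A function $f:\mathbb{Z}^n\to\mathbb{R}\cup\{+\infty\}$ is called DDM-convex if $f(x)+f(y)\ge f(\mu(x,y))+f(\mu(y,x))$ for all $x,y\in\mathbb{Z}^n$. *)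

theory Defs
  imports "HOL-Analysis.Finite_Cartesian_Product" "HOL-Library.Extended_Real"
begin

text \<open>
  Points of the integer lattice are elements of \<^typ>\<open>int ^ 'n\<close>, where the finite index
  type has \<open>n = CARD('n)\<close> elements. A function into the reals extended by plus infinity is
  rendered as an \<^typ>\<open>ereal\<close>-valued function that never takes the value \<open>-\<infinity>\<close>;
  that restriction is not part of the definitions below and has to be assumed separately.
\<close>

definition eff_dom :: "(int ^ 'n \<Rightarrow> ereal) \<Rightarrow> (int ^ 'n) set" where
  "eff_dom f = {x. f x < \<infinity>}"

definition argmin_set :: "(int ^ 'n \<Rightarrow> ereal) \<Rightarrow> (int ^ 'n) set" where
  "argmin_set f = {x. \<forall>z. f x \<le> f z}"

definition ddm_mid :: "int ^ 'n \<Rightarrow> int ^ 'n \<Rightarrow> int ^ 'n" where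
  "ddm_mid x y = (\<chi> i. if x $ i \<ge> y $ i
                       then \<lceil>real_of_int (x $ i + y $ i) / 2\<rceil>
                       else \<lfloor>real_of_int (x $ i + y $ i) / 2\<rfloor>)"

definition ddm_convex :: "(int ^ 'n \<Rightarrow> ereal) \<Rightarrow> bool" where
  "ddm_convex f \<longleftrightarrow> (\<forall>x y. f x + f y \<ge> f (ddm_mid x y) + f (ddm_mid y x))"

text \<open>The library's \<open>infnorm\<close> only applies to Euclidean spaces over the reals.\<close>

definition linf_norm :: "int ^ 'n \<Rightarrow> int" where
  "linf_norm x = (MAX i. \<bar>x $ i\<bar>)"

end

theory Submission
  imports Defs
begin

text \<open>
  Put \<open>x = xa\<close> and let \<open>y\<close> be a point at distance \<open>m\<close> from \<open>x\<close>. The difference \<open>y - x\<close> is a sum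
  of \<open>m\<close> sign vectors, its levels: level \<open>j\<close> has the entry \<open>sgn (y\<^sub>i - x\<^sub>i)\<close> at every \<open>i\<close> with
  \<open>j < \<bar>y\<^sub>i - x\<^sub>i\<bar>\<close>. A set \<open>J\<close> of levels selects a point between \<open>x\<close> and \<open>y\<close>, namely \<open>x\<close> plus
  the levels in \<open>J\<close>, so \<open>f\<close> becomes a function \<open>g\<close> of sets of levels.

  For \<open>J \<subseteq> K\<close>, the two directed midpoints of the points of \<open>J\<close> and \<open>K\<close> are obtained by adding to
  \<open>J\<close> every second element of \<open>K - J\<close>, or the other half of \<open>K - J\<close>. On intervals of length two,
  DDM-convexity is therefore local submodularity of \<open>g\<close>. On longer intervals it shows that
  \<open>g\<close> is finite on the whole interval as soon as it is finite at both ends, and this makes it possible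
  to sum up the local inequalities. The outcome is the parallelogram inequality
  \<open>f x + f y \<ge> f (x + v) + f (y - v)\<close> for every sum \<open>v\<close> of levels (\<open>parallelogram_inequality\<close>).

  If \<open>m > n (\<alpha> - 1)\<close>, then some \<open>\<alpha>\<close> consecutive levels are equal, because the levels change only at
  the at most \<open>n\<close> values \<open>\<bar>y\<^sub>i - x\<^sub>i\<bar>\<close>. Their sum is \<open>\<alpha> d\<close> with \<open>d \<in> {-1, 0, 1}\<^sup>n\<close>, so
  \<open>f x \<le> f (x + \<alpha> d)\<close> and the parallelogram inequality leaves \<open>f (y - \<alpha> d) \<le> f y\<close>. As
  \<open>y - \<alpha> d\<close> is strictly closer to \<open>x\<close>, iterating leads into the box of radius \<open>n (\<alpha> - 1)\<close> without
  increasing \<open>f\<close>. Hence a minimizer over this finite box is a global one.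
\<close>

section \<open>Submodularity of extended real set functions\<close>

text \<open>
  Local submodularity alone would not suffice below, since it says nothing when
  the intermediate values are infinite. Splitting every interval of length at least two somewhere
  also controls where the function is finite.
\<close>

definition splits_intervals :: "('a set \<Rightarrow> ereal) \<Rightarrow> bool" where
  "splits_intervals g \<longleftrightarrow>
     (\<forall>J K. finite K \<longrightarrow> J \<subseteq> K \<longrightarrow> 2 \<le> card (K - J) \<longrightarrow>
        (\<exists>T. J \<subset> T \<and> T \<subset> K \<and> g T + g (J \<union> (K - T)) \<le> g J + g K))"

text \<open>
  At a splitting set \<open>T\<close> and at its complement in the interval, \<open>g\<close> is finite. Induction on the
  intervals below and above \<open>T\<close> reaches \<open>L \<inter> T\<close> and \<open>L \<union> T\<close>, and the interval between these
  is shorter than the given one unless \<open>L\<close> is that complement.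
\<close>

lemma splits_intervals_finite_between:
  assumes g: "splits_intervals g" and not_minf: "\<And>A. g A \<noteq> -\<infinity>"
    and "finite K" "J \<subseteq> L" "L \<subseteq> K" "g J < \<infinity>" "g K < \<infinity>"
  shows "g L < \<infinity>"
  using assms(3-)
proof (induction "card (K - J)" arbitrary: J K L rule: less_induct)
  case less
  have fin: "finite (K - J)" using less.prems by simp
  show ?case
  proof (cases "2 \<le> card (K - J)")
    case False
    then have "card (K - J) \<le> Suc 0" by simp
    then have same: "p = q" if "p \<in> K - J" "q \<in> K - J" for p q
      using that by (simp only: card_le_Suc0_iff_eq[OF fin])
    have "L = J \<or> L = K"
    proof (rule ccontr)
      assume "\<not> ?thesis"
      then obtain p q where "p \<in> L" "p \<notin> J" "q \<in> K" "q \<notin> L"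
        using \<open>J \<subseteq> L\<close> \<open>L \<subseteq> K\<close> by auto
      moreover from this have "p = q"
        using \<open>J \<subseteq> L\<close> \<open>L \<subseteq> K\<close> by (intro same) auto
      ultimately show False by simp
    qed
    then show ?thesis using \<open>g J < \<infinity>\<close> \<open>g K < \<infinity>\<close> by metis
  next
    case True
    have JK: "J \<subseteq> K" using \<open>J \<subseteq> L\<close> \<open>L \<subseteq> K\<close> by (rule subset_trans)
    obtain T where T: "J \<subset> T" "T \<subset> K" "g T + g (J \<union> (K - T)) \<le> g J + g K"
      using g[unfolded splits_intervals_def, rule_format, OF \<open>finite K\<close> JK True] by blast
    have finT: "finite T" using T(2) \<open>finite K\<close> by (metis finite_subset psubset_imp_subset)
    have "g J + g K < \<infinity>" using less.prems by (cases "g J"; cases "g K") auto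
    then have sum: "g T + g (J \<union> (K - T)) < \<infinity>" using T(3) by (rule order.strict_trans1[rotated])
    have fT: "g T < \<infinity>" and fT': "g (J \<union> (K - T)) < \<infinity>"
      using sum not_minf[of T] not_minf[of "J \<union> (K - T)"]
      by (cases "g T"; cases "g (J \<union> (K - T))"; auto)+
    show ?thesis
    proof (cases "L = J \<union> (K - T)")
      case True
      then show ?thesis using fT' by simp
    next
      case False
      have "card (T - J) < card (K - J)" "card (K - T) < card (K - J)"
        by (rule psubset_card_mono[OF fin]; use T in blast)+
      then have below: "g (L \<inter> T) < \<infinity>" and above: "g (L \<union> T) < \<infinity>"
        using less.hyps[of T J "L \<inter> T", OF _ finT _ _ \<open>g J < \<infinity>\<close> fT]
          less.hyps[of K T "L \<union> T", OF _ \<open>finite K\<close> _ _ fT \<open>g K < \<infinity>\<close>]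
          \<open>J \<subseteq> L\<close> \<open>L \<subseteq> K\<close> T(1,2)
        by (simp_all add: psubset_imp_subset)
      have "(L \<union> T) - (L \<inter> T) \<subset> K - J"
        using False \<open>J \<subseteq> L\<close> \<open>L \<subseteq> K\<close> T(1,2) by blast
      then have "card ((L \<union> T) - (L \<inter> T)) < card (K - J)"
        by (rule psubset_card_mono[OF fin])
      moreover have "finite (L \<union> T)"
        using finT \<open>L \<subseteq> K\<close> \<open>finite K\<close> by (metis finite_Un finite_subset)
      ultimately show ?thesis
        using below above by (intro less.hyps[of "L \<union> T" "L \<inter> T" L]) simp_all
    qed
  qed
qed

text \<open>
  Intervals of length two are split into the only two intermediate sets. On a longer interval one
  of the two parts has at least two elements; moving an element \<open>a\<close> out of it cuts the inequality into
  two inequalities on shorter intervals, and the finite values at \<open>L - {a}\<close> and \<open>K - {a}\<close> cancel.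
\<close>

lemma splits_intervals_submodular:
  assumes g: "splits_intervals g" and not_minf: "\<And>A. g A \<noteq> -\<infinity>"
    and "finite K" "J \<subseteq> L" "L \<subseteq> K"
  shows "g L + g (J \<union> (K - L)) \<le> g J + g K"
proof (cases "g J < \<infinity> \<and> g K < \<infinity>")
  case False
  then have "g J = \<infinity> \<or> g K = \<infinity>" by auto
  then show ?thesis by (rule disjE) simp_all
next
  case True
  then show ?thesis using assms(3-)
  proof (induction "card (K - J)" arbitrary: J K L rule: less_induct)
    case less
    have fin: "finite (K - J)" using less.prems by simp
    have between: "g A < \<infinity>" if "J \<subseteq> A" "A \<subseteq> K" for A
      using splits_intervals_finite_between[OF g not_minf \<open>finite K\<close> that] less.prems(1) by blast
    have real_valued: "\<exists>r. g A = ereal r" if "J \<subseteq> A" "A \<subseteq> K" for A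
      using between[OF that] not_minf[of A] by (cases "g A") simp_all
    have large: "g L + g (J \<union> (K - L)) \<le> g J + g K"
      if L: "J \<subseteq> L" "L \<subseteq> K" "L \<noteq> K" "2 \<le> card (L - J)" for L
    proof -
      have "L - J \<noteq> {}" using L(4) by force
      then obtain a where a: "a \<in> L" "a \<notin> J" by blast
      define L' where "L' = L - {a}"
      have L': "J \<subset> L'"
      proof -
        have "L - J \<noteq> {a}" using L(4) by auto
        then show ?thesis using a L unfolding L'_def by blast
      qed
      have fL': "g L' < \<infinity>" and fKa: "g (K - {a}) < \<infinity>"
      proof -
        have "J \<subseteq> L'" "L' \<subseteq> K" "J \<subseteq> K - {a}" "K - {a} \<subseteq> K"
          using a(2) L(1,2) L' unfolding L'_def by blast+
        then show "g L' < \<infinity>" "g (K - {a}) < \<infinity>" using between by blast+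
      qed
      have c1: "card (K - {a} - J) < card (K - J)"
        by (rule psubset_card_mono[OF fin]) (use a L in blast)
      have c2: "card (K - L') < card (K - J)"
        by (rule psubset_card_mono[OF fin]) (use L' L L'_def in blast)
      have e1: "J \<union> (K - {a} - L') = J \<union> (K - L)" and e2: "L' \<union> (K - L) = K - {a}"
        using a L unfolding L'_def by blast+
      have "g L' + g (J \<union> (K - L)) \<le> g J + g (K - {a})"
      proof -
        have "J \<subseteq> L'" "L' \<subseteq> K - {a}" using L(2) L' unfolding L'_def by blast+
        then show ?thesis
          using less.hyps[OF c1, of L'] less.prems(1) \<open>finite K\<close> fKa unfolding e1 by simp
      qed
      moreover have "g L + g (K - {a}) \<le> g L' + g K"
      proof -
        have "L' \<subseteq> L" unfolding L'_def by blast
        then show ?thesis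
          using less.hyps[OF c2, of L] less.prems(1) \<open>finite K\<close> fL' L(2) unfolding e2 by simp
      qed
      moreover obtain r1 r2 r3 r4 r5 r6 where "g L = ereal r1" "g L' = ereal r2" "g J = ereal r3"
        "g K = ereal r4" "g (K - {a}) = ereal r5" "g (J \<union> (K - L)) = ereal r6"
      proof -
        have "J \<subseteq> K" "L' \<subseteq> K" "J \<subseteq> L'" "J \<subseteq> K - {a}"
          using a(2) L(1,2) L' unfolding L'_def by blast+
        then have "\<exists>r1. g L = ereal r1" "\<exists>r2. g L' = ereal r2" "\<exists>r3. g J = ereal r3"
          "\<exists>r4. g K = ereal r4" "\<exists>r5. g (K - {a}) = ereal r5" "\<exists>r6. g (J \<union> (K - L)) = ereal r6"
          using L(1,2) by (intro real_valued; blast)+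
        then show ?thesis using that by blast
      qed
      ultimately show ?thesis by simp
    qed
    define L2 where "L2 = J \<union> (K - L)"
    have L2: "J \<subseteq> L2" "L2 \<subseteq> K" "J \<union> (K - L2) = L"
      using \<open>J \<subseteq> L\<close> \<open>L \<subseteq> K\<close> unfolding L2_def by blast+
    consider "L = J" | "L = K" | "L \<noteq> K" "2 \<le> card (L - J)" | "L2 \<noteq> K" "2 \<le> card (L2 - J)"
      | "card (L - J) = 1" "card (L2 - J) = 1"
    proof -
      have "card (L - J) \<noteq> 0" if "L \<noteq> J"
        using that \<open>J \<subseteq> L\<close> finite_subset[OF \<open>L \<subseteq> K\<close> \<open>finite K\<close>] by simp
      moreover have "card (L2 - J) \<noteq> 0" if "L \<noteq> K"
      proof -
        have "L2 - J \<noteq> {}" using that \<open>J \<subseteq> L\<close> \<open>L \<subseteq> K\<close> unfolding L2_def by blast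
        then show ?thesis using finite_subset[OF \<open>L2 \<subseteq> K\<close> \<open>finite K\<close>] by simp
      qed
      moreover have "L2 \<noteq> K" if "L \<noteq> J"
        using that \<open>J \<subseteq> L\<close> \<open>L \<subseteq> K\<close> unfolding L2_def by blast
      ultimately show ?thesis using that by linarith
    qed
    then show ?case
    proof cases
      case 1
      then show ?thesis using \<open>L \<subseteq> K\<close> by (simp add: Un_absorb1)
    next
      case 2
      then show ?thesis by (simp add: add.commute)
    next
      case 3
      then show ?thesis using large \<open>J \<subseteq> L\<close> \<open>L \<subseteq> K\<close> by blast
    next
      case 4
      then show ?thesis
        using large[of L2] L2 unfolding L2_def by (simp add: add.commute)
    next
      case 5
      then obtain a b where ab: "L - J = {a}" "L2 - J = {b}"
        by (meson card_1_singletonE)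
      have KJ: "K - J = {a, b}" "a \<noteq> b"
        using ab \<open>J \<subseteq> L\<close> \<open>L \<subseteq> K\<close> unfolding L2_def by blast+
      then have "2 \<le> card (K - J)" by simp
      then obtain T where T: "J \<subset> T" "T \<subset> K" "g T + g (J \<union> (K - T)) \<le> g J + g K"
        using g \<open>finite K\<close> L2(1,2) unfolding splits_intervals_def by (metis subset_trans)
      have K: "K = J \<union> {a, b}" and LJ: "L = J \<union> {a}" and L2J: "L2 = J \<union> {b}"
        using Diff_partition[OF subset_trans[OF L2(1,2)]] Diff_partition[OF \<open>J \<subseteq> L\<close>]
          Diff_partition[OF L2(1)] KJ(1) ab by simp_all
      have "T = J \<union> {a} \<or> T = J \<union> {b}"
      proof (cases "a \<in> T")
        case True
        then have "b \<notin> T" using T(1,2) unfolding K by fast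
        then have "T = J \<union> {a}" using True T(1,2) unfolding K by fast
        then show ?thesis by (rule disjI1)
      next
        case False
        then have "T = J \<union> {b}" using T(1,2) unfolding K by fast
        then show ?thesis by (rule disjI2)
      qed
      then have "T = L \<or> T = L2" unfolding LJ L2J .
      then show ?thesis
      proof
        assume "T = L"
        then show ?thesis using T(3) by simp
      next
        assume "T = L2"
        then have "g L2 + g L \<le> g J + g K" using T(3) L2(3) by simp
        then show ?thesis by (simp add: L2_def add.commute)
      qed
    qed
  qed
qed

section \<open>The parallelogram inequality for DDM-convex functions\<close>

definition even_ranked :: "nat set \<Rightarrow> nat set" where
  "even_ranked S = {s \<in> S. even (card (S \<inter> {..s}))}"

lemma card_even_ranked_lessThan:
  "card (even_ranked S \<inter> {..<k}) = card (S \<inter> {..<k}) div 2"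
proof (induction k)
  case (Suc k)
  have step: "A \<inter> {..<Suc k} = (if k \<in> A then insert k (A \<inter> {..<k}) else A \<inter> {..<k})" for A
    by (auto simp: less_Suc_eq)
  have "S \<inter> {..k} = S \<inter> {..<Suc k}" by auto
  then have "k \<in> even_ranked S \<longleftrightarrow> k \<in> S \<and> odd (card (S \<inter> {..<k}))"
    unfolding even_ranked_def by (auto simp: step)
  then show ?case using Suc.IH by (auto simp: step even_ranked_def)
qed simp

definition level_point :: "int ^ 'n \<Rightarrow> int ^ 'n \<Rightarrow> nat set \<Rightarrow> int ^ 'n" where
  "level_point x y J =
     (\<chi> i. x $ i + sgn (y $ i - x $ i) * int (card (J \<inter> {..<nat \<bar>y $ i - x $ i\<bar>})))"

lemma level_point_empty: "level_point x y {} = x"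
  by (simp add: level_point_def vec_eq_iff)

lemma level_point_full:
  assumes "\<And>i. \<bar>y $ i - x $ i\<bar> \<le> int m"
  shows "level_point x y {..<m} = y"
proof -
  have "{..<m} \<inter> {..<nat \<bar>y $ i - x $ i\<bar>} = {..<nat \<bar>y $ i - x $ i\<bar>}" for i
    using assms[of i] by auto
  then show ?thesis
    by (simp add: level_point_def vec_eq_iff sgn_mult_abs)
qed

text \<open>The directed midpoint rounds each coordinate towards its first argument.\<close>

lemma ddm_mid_nth_offset:
  assumes "s \<in> {-1, 0, 1}" "y $ i = x $ i + s * int c"
  shows "ddm_mid x y $ i = x $ i + s * int (c div 2)"
    and "ddm_mid y x $ i = x $ i + s * int (c - c div 2)"
proof -
  have flo: "\<lfloor>real_of_int z / 2\<rfloor> = z div 2" for z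
    using floor_divide_of_int_eq[of z 2] by simp
  have cei: "\<lceil>real_of_int z / 2\<rceil> = - ((- z) div 2)" for z
    using ceiling_divide_eq_div[of z 2] by simp
  show "ddm_mid x y $ i = x $ i + s * int (c div 2)"
    "ddm_mid y x $ i = x $ i + s * int (c - c div 2)"
    using assms unfolding ddm_mid_def by (auto simp only: vec_lambda_beta flo cei split: if_splits; auto; presburger)+
qed

text \<open>
  Between nested level sets, rounding towards the smaller one keeps every second of the additional
  levels, simultaneously in all coordinates: each coordinate sees an initial segment
  of the additional levels, and the even-ranked elements are half of any such segment, rounded down.
\<close>

lemma ddm_mid_level_point:
  fixes J K :: "nat set"
  assumes "J \<subseteq> K"
  defines "T \<equiv> J \<union> even_ranked (K - J)"
  shows "ddm_mid (level_point x y J) (level_point x y K) = level_point x y T"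
    and "ddm_mid (level_point x y K) (level_point x y J) = level_point x y (J \<union> (K - T))"
proof -
  have sub: "even_ranked (K - J) \<subseteq> K - J" unfolding even_ranked_def by auto
  have "ddm_mid (level_point x y J) (level_point x y K) $ i = level_point x y T $ i
     \<and> ddm_mid (level_point x y K) (level_point x y J) $ i = level_point x y (J \<union> (K - T)) $ i" for i
  proof -
    define I where "I = {..<nat \<bar>y $ i - x $ i\<bar>}"
    define s where "s = sgn (y $ i - x $ i)"
    define c where "c = card ((K - J) \<inter> I)"
    have half: "card (even_ranked (K - J) \<inter> I) = c div 2"
      unfolding c_def I_def by (rule card_even_ranked_lessThan)
    have s: "s \<in> {-1, 0, 1}" unfolding s_def by (simp add: sgn_if)
    have cK: "card (K \<inter> I) = card (J \<inter> I) + c"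
      unfolding c_def using assms(1)
      by (subst card_Un_disjoint[symmetric]) (auto simp: I_def intro!: arg_cong[where f = card])
    have cT: "card (T \<inter> I) = card (J \<inter> I) + c div 2"
      unfolding half[symmetric] T_def using sub
      by (subst card_Un_disjoint[symmetric]) (auto simp: I_def intro!: arg_cong[where f = card])
    have "card ((K - J) \<inter> I - even_ranked (K - J) \<inter> I) = c - c div 2"
    proof -
      have "finite (even_ranked (K - J) \<inter> I)" unfolding I_def by simp
      moreover have "even_ranked (K - J) \<inter> I \<subseteq> (K - J) \<inter> I" using sub by blast
      ultimately show ?thesis
        using half unfolding c_def by (simp only: card_Diff_subset)
    qed
    moreover have "(J \<union> (K - T)) \<inter> I = (J \<inter> I) \<union> ((K - J) \<inter> I - even_ranked (K - J) \<inter> I)"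
      unfolding T_def by blast
    ultimately have cT': "card ((J \<union> (K - T)) \<inter> I) = card (J \<inter> I) + (c - c div 2)"
      by (simp add: card_Un_disjoint I_def Int_Diff disjoint_iff)
    have P: "level_point x y A $ i = x $ i + s * int (card (A \<inter> I))" for A
      unfolding level_point_def I_def s_def by simp
    have "level_point x y K $ i = level_point x y J $ i + s * int c"
      unfolding P cK by (simp add: algebra_simps)
    from ddm_mid_nth_offset[OF s this] show ?thesis
      unfolding P cT cT' by (simp add: algebra_simps)
  qed
  then show "ddm_mid (level_point x y J) (level_point x y K) = level_point x y T"
    and "ddm_mid (level_point x y K) (level_point x y J) = level_point x y (J \<union> (K - T))"
    by (simp_all add: vec_eq_iff)
qed

lemma ddm_convex_splits_intervals:
  assumes "ddm_convex f"
  shows "splits_intervals (\<lambda>J. f (level_point x y J))"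
  unfolding splits_intervals_def
proof (intro allI impI)
  fix J K :: "nat set"
  assume JK: "finite K" "J \<subseteq> K" "2 \<le> card (K - J)"
  define E where "E = even_ranked (K - J)"
  have E: "E \<subseteq> K - J" unfolding E_def even_ranked_def by auto
  have "card E = card (K - J) div 2"
  proof -
    obtain k where "K \<subseteq> {..<k}" using finite_nat_iff_bounded JK(1) by blast
    then have "E \<inter> {..<k} = E" "(K - J) \<inter> {..<k} = K - J" using E by auto
    then show ?thesis using card_even_ranked_lessThan[of "K - J" k] unfolding E_def by simp
  qed
  then have "E \<noteq> {}" "E \<noteq> K - J" using JK(3) by auto
  then have "J \<subset> J \<union> E" "J \<union> E \<subset> K" using E JK(2) by blast+
  moreover have "f (level_point x y (J \<union> E)) + f (level_point x y (J \<union> (K - (J \<union> E))))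
      \<le> f (level_point x y J) + f (level_point x y K)"
    using assms ddm_mid_level_point[OF JK(2), of x y] unfolding ddm_convex_def E_def by metis
  ultimately show "\<exists>T. J \<subset> T \<and> T \<subset> K \<and> f (level_point x y T) + f (level_point x y (J \<union> (K - T)))
      \<le> f (level_point x y J) + f (level_point x y K)"
    by blast
qed

lemma parallelogram_inequality:
  assumes "ddm_convex f" "\<And>x. f x \<noteq> -\<infinity>"
    and "\<And>i. \<bar>y $ i - x $ i\<bar> \<le> int m" "L \<subseteq> {..<m}"
  shows "f (level_point x y L) + f (level_point x y ({..<m} - L)) \<le> f x + f y"
  using splits_intervals_submodular[OF ddm_convex_splits_intervals[OF assms(1), of x y],
      of "{..<m}" "{}" L] assms(2,4)
  by (simp add: level_point_empty level_point_full[OF assms(3)])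

section \<open>Proximity\<close>

lemma linf_norm_le_iff: "linf_norm x \<le> r \<longleftrightarrow> (\<forall>i. \<bar>x $ i\<bar> \<le> r)"
  unfolding linf_norm_def by (subst Max_le_iff) auto

lemma linf_norm_nonneg: "0 \<le> linf_norm x"
  using linf_norm_le_iff[of x "linf_norm x"] abs_ge_zero order_trans by blast

lemma linf_norm_attained: "\<exists>i. \<bar>x $ i\<bar> = linf_norm x"
proof -
  have "linf_norm x \<in> range (\<lambda>i. \<bar>x $ i\<bar>)"
    unfolding linf_norm_def by (rule Max_in) auto
  then show ?thesis by auto
qed

lemma finite_linf_ball:
  fixes x :: "int ^ 'n"
  shows "finite {y. linf_norm (x - y) \<le> r}"
proof (rule finite_subset)
  show "{y. linf_norm (x - y) \<le> r}
      \<subseteq> vec_lambda ` (PiE UNIV (\<lambda>i. {x $ i - r..x $ i + r}))"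
  proof
    fix y assume "y \<in> {y. linf_norm (x - y) \<le> r}"
    then have "\<bar>x $ i - y $ i\<bar> \<le> r" for i by (simp add: linf_norm_le_iff)
    then have "x $ i - r \<le> y $ i \<and> y $ i \<le> x $ i + r" for i by (smt (verit))
    then have "vec_nth y \<in> PiE UNIV (\<lambda>i. {x $ i - r..x $ i + r})" by auto
    then show "y \<in> vec_lambda ` (PiE UNIV (\<lambda>i. {x $ i - r..x $ i + r}))"
      by (metis image_eqI vec_nth_inverse)
  qed
  show "finite (vec_lambda ` (PiE UNIV (\<lambda>i. {x $ i - r..x $ i + r})))"
    by (rule finite_imageI, rule finite_PiE) simp_all
qed

text \<open>
  Each value \<open>k i\<close> spoils at most the \<open>a - 1\<close> starting points \<open>t\<close> with \<open>t < k i < t + a\<close>.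
\<close>

lemma gap_pigeonhole:
  fixes k :: "'n::finite \<Rightarrow> nat"
  assumes "CARD('n) * (a - 1) < m"
  shows "\<exists>t<m. \<forall>i. k i \<le> t \<or> t + a \<le> k i"
proof (rule ccontr)
  assume neg: "\<not> ?thesis"
  have "{..<m} \<subseteq> (\<Union>i. {k i - (a - 1)..<k i})"
  proof
    fix t assume "t \<in> {..<m}"
    then obtain i where "t < k i" "k i < t + a" using neg by (auto simp: not_le)
    then show "t \<in> (\<Union>i. {k i - (a - 1)..<k i})" by (auto intro!: exI[of _ i])
  qed
  then have "m \<le> card (\<Union>i. {k i - (a - 1)..<k i})"
    by (metis card_lessThan card_mono finite_UN finite_atLeastLessThan finite_class.finite_UNIV)
  also have "\<dots> \<le> (\<Sum>i\<in>UNIV. card {k i - (a - 1)..<k i})"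
    by (rule card_UN_le) simp
  also have "\<dots> \<le> (\<Sum>i\<in>(UNIV :: 'n set). a - 1)"
    by (rule sum_mono) simp
  finally show False using assms by simp
qed

text \<open>
  The levels \<open>{t..<t + a}\<close> found by \<open>gap_pigeonhole\<close> all equal one sign vector \<open>d\<close>, and every
  coordinate at maximal distance is in its support; so removing them shortens the
  distance to \<open>x\<close>.
\<close>

lemma descent_towards_scaled_local_minimizer:
  fixes f :: "int ^ 'n \<Rightarrow> ereal" and \<alpha> :: int
  assumes not_minf: "\<And>x. f x \<noteq> -\<infinity>" and "ddm_convex f" and "\<alpha> > 0" and "f x < \<infinity>"
    and local_min: "\<And>d :: int ^ 'n. (\<forall>i. d $ i \<in> {-1, 0, 1}) \<Longrightarrow> f x \<le> f (x + \<alpha> *s d)"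
    and far: "int CARD('n) * (\<alpha> - 1) < linf_norm (x - y)"
  shows "\<exists>z. f z \<le> f y \<and> linf_norm (x - z) < linf_norm (x - y)"
proof -
  define a where "a = nat \<alpha>"
  define m where "m = nat (linf_norm (x - y))"
  define k where "k i = nat \<bar>y $ i - x $ i\<bar>" for i
  have a: "a > 0" "\<alpha> = int a" using \<open>\<alpha> > 0\<close> unfolding a_def by auto
  have m: "linf_norm (x - y) = int m" using linf_norm_nonneg unfolding m_def by simp
  have dist: "\<bar>y $ i - x $ i\<bar> \<le> int m" for i
    using linf_norm_le_iff[of "x - y" "int m"] m by (simp add: abs_minus_commute)
  have "int (CARD('n) * (a - 1)) < int m"
    using far a unfolding m by (simp add: of_nat_diff)
  then have "CARD('n) * (a - 1) < m" by (simp only: of_nat_less_iff)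
  then obtain t where t: "t < m" "\<And>i. k i \<le> t \<or> t + a \<le> k i"
    using gap_pigeonhole by blast
  obtain j where "\<bar>(x - y) $ j\<bar> = int m"
    using linf_norm_attained[of "x - y"] unfolding m by blast
  then have "k j = m" unfolding k_def by (simp add: abs_minus_commute[of "y $ j"])
  then have tam: "t + a \<le> m" using t(1) t(2)[of j] by auto
  define L where "L = {t..<t + a}"
  define d :: "int ^ 'n" where "d = (\<chi> i. if k i \<le> t then 0 else sgn (y $ i - x $ i))"
  define z where "z = level_point x y ({..<m} - L)"
  have cL: "card (L \<inter> {..<k i}) = (if k i \<le> t then 0 else a)" for i
  proof -
    have "L \<inter> {..<k i} = (if k i \<le> t then {} else L)"
      using t(2)[of i] unfolding L_def by auto
    then show ?thesis by (simp add: L_def)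
  qed
  have "level_point x y L = x + \<alpha> *s d"
    unfolding vec_eq_iff level_point_def k_def[symmetric] by (simp add: cL d_def a(2))
  moreover have "f x \<le> f (x + \<alpha> *s d)"
    by (rule local_min) (auto simp: d_def sgn_if)
  moreover have "f (level_point x y L) + f z \<le> f x + f y"
    unfolding z_def
    by (rule parallelogram_inequality) (use assms dist tam in \<open>auto simp: L_def\<close>)
  ultimately have "f x + f z \<le> f x + f y"
    by (metis add_right_mono order_trans)
  then have "f z \<le> f y"
    using \<open>f x < \<infinity>\<close> not_minf[of x] by (cases "f x"; cases "f z"; cases "f y") auto
  moreover have "\<bar>(x - z) $ i\<bar> \<le> int m - 1" for i
  proof -
    have km: "k i \<le> m" using dist[of i] unfolding k_def by simp
    have "card (({..<m} - L) \<inter> {..<k i}) = k i - (if k i \<le> t then 0 else a)"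
    proof -
      have "({..<m} - L) \<inter> {..<k i} = {..<k i} - L \<inter> {..<k i}" using km by auto
      then show ?thesis by (simp add: card_Diff_subset cL)
    qed
    also have "\<dots> \<le> m - 1" using km t(1) a(1) by auto
    finally have "card (({..<m} - L) \<inter> {..<k i}) \<le> m - 1" .
    then have "int (card (({..<m} - L) \<inter> {..<k i})) \<le> int m - 1" using t(1) by linarith
    moreover have "\<bar>(x - z) $ i\<bar> \<le> int (card (({..<m} - L) \<inter> {..<k i}))"
      unfolding z_def level_point_def k_def by (auto simp: sgn_if)
    ultimately show ?thesis by linarith
  qed
  then have "linf_norm (x - z) < linf_norm (x - y)"
    using linf_norm_le_iff[of "x - z" "int m - 1"] unfolding m by auto
  ultimately show ?thesis by blast
qed

theorem theorem7p3:
  fixes f :: "int ^ 'n \<Rightarrow> ereal" and \<alpha> :: int and xa :: "int ^ 'n"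
  assumes "\<And>x. f x \<noteq> -\<infinity>"
    and "ddm_convex f"
    and "\<alpha> > 0"
    and "xa \<in> eff_dom f"
    and "\<And>d :: int ^ 'n. (\<forall>i. d $ i \<in> {-1, 0, 1}) \<Longrightarrow> f xa \<le> f (xa + \<alpha> *s d)"
  shows "\<exists>xs. xs \<in> argmin_set f \<and> linf_norm (xa - xs) \<le> int CARD('n) * (\<alpha> - 1)"
proof -
  define B where "B = {y. linf_norm (xa - y) \<le> int CARD('n) * (\<alpha> - 1)}"
  have fin: "finite B" unfolding B_def by (rule finite_linf_ball)
  have "xa \<in> B" using \<open>\<alpha> > 0\<close> unfolding B_def by (simp add: linf_norm_le_iff)
  then obtain xs where xs: "xs \<in> B" "\<And>y. y \<in> B \<Longrightarrow> f xs \<le> f y"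
    using finite_has_minimal[of "f ` B"] fin
    by (metis (no_types, lifting) finite_imageI imageE image_eqI empty_iff linorder_le_cases)
  have "f xs \<le> f y" for y
  proof (induction "nat (linf_norm (xa - y))" arbitrary: y rule: less_induct)
    case less
    show ?case
    proof (cases "y \<in> B")
      case True
      then show ?thesis by (rule xs(2))
    next
      case False
      then have "int CARD('n) * (\<alpha> - 1) < linf_norm (xa - y)" unfolding B_def by simp
      moreover have "f xa < \<infinity>" using assms(4) unfolding eff_dom_def by simp
      ultimately obtain z where z: "f z \<le> f y" "linf_norm (xa - z) < linf_norm (xa - y)"
        using descent_towards_scaled_local_minimizer[of f \<alpha> xa y] assms(1-3,5) by blast
      then have "nat (linf_norm (xa - z)) < nat (linf_norm (xa - y))"
        using linf_norm_nonneg[of "xa - z"] by simp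
      then show ?thesis using less z(1) by (meson order_trans)
    qed
  qed
  then show ?thesis using xs(1) unfolding argmin_set_def B_def by blast
qed

end
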